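(* Let $\mathcal{Q}$ be a nonempty set of channels from $\mathbb{X}$ to $\mathbb{Y}$. (i) Suppose $\mathcal{Q}$ is weakly compact at input $P$, $c:\mathbb{X}\times\mathbb{U}\to\mathbb{R}$ is non-negative, bounded, and continuous on $\mathbb{X}\times\mathbb{U}$, and $\mathbb{U}$ is compact and convex. Then there exists a worst channel in $\mathcal{Q}$, i.e. a solution of the maximization problem $$\sup_{Q\in\mathcal{Q}}J(P,Q).$$ (ii) Suppose $\mathcal{Q}$ is setwise compact at input $P$ and $c:\mathbb{X}\times\mathbb{U}\to\mathbb{R}$ is non-negative, measurable, and bounded. Then there exists a worst channel in $\mathcal{Q}$, i.e. some $Q^*\in\mathcal{Q}$ with $J(P,Q^* )=\sup_{Q\in\mathcal{Q}}J(P,Q)$. (iii) Suppose $\mathcal{Q}$ is compact under total variation at input $P$ and $c:\mathbb{X}\times\mathbb{U}\to\mathbb{R}$ is non-negative, measurable, and bounded. Then there exist best and worst channels in $\mathcal{Q}$, i.e. solutions of the minimization problem $\inf_{Q\in\mathcal{Q}}J(P,Q)$ and of the maximization problem $\sup_{Q\in\mathcal{Q}}J(P,Q)$.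
   Context: $\mathbb{X}=\mathbb{R}^n$, $\mathbb{Y}=\mathbb{R}^m$, and $\mathbb{U}\subset\mathbb{R}^k$ is a nonempty Borel set. A channel $Q$ is a stochastic kernel from $\mathbb{X}$ to $\mathbb{Y}$: $Q(\cdot|x)$ is a Borel probability measure on $\mathbb{Y}$ for every $x\in\mathbb{X}$, and $x\mapsto Q(A|x)$ is Borel measurable for every Borel $A\subset\mathbb{Y}$. $P$ is a fixed Borel probability measure on $\mathbb{X}$, and $PQ$ is the joint probability measure on $\mathbb{X}\times\mathbb{Y}$ given by $PQ(A)=\int_A Q(dy|x)P(dx)$. The single-stage optimal cost is $$J(P,Q)=\inf_{\gamma\in\mathcal{G}}\int_{\mathbb{X}\times\mathbb{Y}} c(x,\gamma(y))\,Q(dy|x)P(dx),$$ where $\mathcal{G}$ is the set of all Borel measurable functions $\gamma:\mathbb{Y}\to\mathbb{U}$. $Q_n\to Q$ weakly (resp. setwise, in total variation) at input $P$ means that $PQ_n\to PQ$ weakly, i.e. integrals of bounded continuous functions converge (resp. $PQ_n(A)\to PQ(A)$ for every Borel $A\subset\mathbb{X}\times\mathbb{Y}$; resp. $\|PQ_n-PQ\|_{TV}\to 0$, where $\|\mu-\nu\|_{TV}=2\sup_B|\mu(B)-\nu(B)|$ over Borel sets $B$). For each of these three modes, compactness and sequential compactness coincide, and a set $\mathcal{Q}$ of channels is called compact (at input $P$) if every sequence in $\mathcal{Q}$ has a subsequence converging in that mode at input $P$ to some channel in $\mathcal{Q}$. *)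

theory Defs
  imports "HOL-Probability.Probability"
begin

text \<open>
  A channel is a stochastic kernel, i.e. a Borel measurable map into the library's space of
  Borel probability measures; \<open>is_channel_iff\<close> spells this out.
\<close>

definition is_channel :: "('x::topological_space \<Rightarrow> 'y::topological_space measure) \<Rightarrow> bool" where
  "is_channel Q \<longleftrightarrow> Q \<in> borel \<rightarrow>\<^sub>M prob_algebra borel"

lemma is_channel_iff:
  "is_channel Q \<longleftrightarrow>
     (\<forall>x. prob_space (Q x) \<and> sets (Q x) = sets borel) \<and>
     (\<forall>A\<in>sets borel. (\<lambda>x. measure (Q x) A) \<in> borel_measurable borel)"
proof
  assume Q: "is_channel Q"
  have "Q x \<in> space (prob_algebra borel)" for x
    using measurable_space[OF Q[unfolded is_channel_def]] by simp
  then have "\<forall>x. prob_space (Q x) \<and> sets (Q x) = sets borel"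
    by (simp add: space_prob_algebra)
  moreover have "(\<lambda>x. measure (Q x) A) \<in> borel_measurable borel" if "A \<in> sets borel" for A
    by (rule measurable_compose[OF measurable_prob_algebraD[OF Q[unfolded is_channel_def]]
          measurable_measure_subprob_algebra[OF that]])
  ultimately show "(\<forall>x. prob_space (Q x) \<and> sets (Q x) = sets borel) \<and>
     (\<forall>A\<in>sets borel. (\<lambda>x. measure (Q x) A) \<in> borel_measurable borel)" by blast
next
  assume *: "(\<forall>x. prob_space (Q x) \<and> sets (Q x) = sets borel) \<and>
     (\<forall>A\<in>sets borel. (\<lambda>x. measure (Q x) A) \<in> borel_measurable borel)"
  have "(\<lambda>x. emeasure (Q x) A) \<in> borel_measurable borel" if "A \<in> sets borel" for A
  proof -
    have "emeasure (Q x) A = ennreal (measure (Q x) A)" for x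
      using * by (intro finite_measure.emeasure_eq_measure prob_space.finite_measure) blast
    moreover have "(\<lambda>x. measure (Q x) A) \<in> borel_measurable borel" using * that by blast
    ultimately show ?thesis by simp
  qed
  then have "Q \<in> borel \<rightarrow>\<^sub>M subprob_algebra borel"
    using * by (intro measurable_subprob_algebra) (blast intro: prob_space_imp_subprob_space)+
  then show "is_channel Q"
    unfolding is_channel_def using * by (intro measurable_prob_algebraI) blast+
qed

text \<open>
  The joint measure \<open>PQ\<close> on the product space, as a Giry monad bind; \<open>emeasure_joint\<close>
  is the defining formula \<open>PQ(A) = \<integral>\<^sub>A Q(dy|x) P(dx)\<close>.
\<close>

definition joint ::
  "'x::second_countable_topology measure \<Rightarrow> ('x \<Rightarrow> 'y::second_countable_topology measure) \<Rightarrow> ('x \<times> 'y) measure" where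
  "joint P Q = P \<bind> (\<lambda>x. distr (Q x) borel (Pair x))"

lemma measurable_joint_kernel:
  fixes Q :: "'x::second_countable_topology \<Rightarrow> 'y::second_countable_topology measure"
  assumes "is_channel Q"
  shows "(\<lambda>x. distr (Q x) borel (Pair x)) \<in> borel \<rightarrow>\<^sub>M subprob_algebra borel"
proof -
  have Q: "Q \<in> borel \<rightarrow>\<^sub>M subprob_algebra borel"
    using assms by (simp add: is_channel_def measurable_prob_algebraD)
  show ?thesis
  proof (rule measurable_distr2[OF _ Q])
    have "case_prod Pair = (\<lambda>z :: 'x \<times> 'y. z)" by (auto simp: fun_eq_iff)
    then show "case_prod Pair \<in> borel \<Otimes>\<^sub>M borel \<rightarrow>\<^sub>M (borel :: ('x \<times> 'y) measure)"
      unfolding borel_prod by simp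
  qed
qed

lemma emeasure_joint:
  fixes Q :: "'x::second_countable_topology \<Rightarrow> 'y::second_countable_topology measure"
  assumes "prob_space P" "sets P = sets borel" "is_channel Q" "A \<in> sets borel"
  shows "emeasure (joint P Q) A = (\<integral>\<^sup>+ x. emeasure (Q x) {y. (x, y) \<in> A} \<partial>P)"
proof -
  have sQ: "sets (Q x) = sets borel" for x
    using assms(3) by (simp add: is_channel_iff)
  have m: "(\<lambda>x. distr (Q x) borel (Pair x)) \<in> P \<rightarrow>\<^sub>M subprob_algebra borel"
    using measurable_joint_kernel[OF assms(3)] measurable_cong_sets[OF assms(2) refl] by blast
  have P: "Pair x \<in> Q x \<rightarrow>\<^sub>M borel" for x
  proof -
    have "Pair x \<in> borel \<rightarrow>\<^sub>M (borel :: ('x \<times> 'y) measure)"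
      by (intro borel_measurable_continuous_onI continuous_intros)
    then show ?thesis using measurable_cong_sets[OF sQ refl] by blast
  qed
  have "emeasure (joint P Q) A = (\<integral>\<^sup>+ x. emeasure (distr (Q x) borel (Pair x)) A \<partial>P)"
    unfolding joint_def
    by (rule emeasure_bind[OF prob_space.not_empty[OF assms(1)] m assms(4)])
  also have "\<dots> = (\<integral>\<^sup>+ x. emeasure (Q x) {y. (x, y) \<in> A} \<partial>P)"
    using sets_eq_imp_space_eq[OF sQ]
    by (intro nn_integral_cong) (simp add: emeasure_distr[OF P assms(4)] vimage_def)
  finally show ?thesis .
qed

text \<open>
  The cost \<open>c\<close> and the action set \<open>U\<close> enter only through the values of \<open>c\<close> on \<open>UNIV \<times> U\<close>.
  The infimum is a real one; it is over a nonempty set bounded below by 0 when \<open>U\<close> is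
  nonempty and \<open>c\<close> is non-negative on \<open>UNIV \<times> U\<close>.
\<close>

definition policies :: "'u::topological_space set \<Rightarrow> ('y::topological_space \<Rightarrow> 'u) set" where
  "policies U = borel \<rightarrow>\<^sub>M restrict_space borel U"

definition optimal_cost ::
  "'u::topological_space set \<Rightarrow> ('x \<times> 'u \<Rightarrow> real) \<Rightarrow> 'x::second_countable_topology measure \<Rightarrow>
     ('x \<Rightarrow> 'y::second_countable_topology measure) \<Rightarrow> real" where
  "optimal_cost U c P Q = (INF \<gamma>\<in>policies U. \<integral>(x, y). c (x, \<gamma> y) \<partial>joint P Q)"

definition converges_weakly :: "(nat \<Rightarrow> 'a::topological_space measure) \<Rightarrow> 'a measure \<Rightarrow> bool" where
  "converges_weakly M N \<longleftrightarrow>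
     (\<forall>f :: 'a \<Rightarrow> real. continuous_on UNIV f \<longrightarrow> bounded (range f) \<longrightarrow>
        (\<lambda>i. \<integral>z. f z \<partial>M i) \<longlonglongrightarrow> (\<integral>z. f z \<partial>N))"

definition converges_setwise :: "(nat \<Rightarrow> 'a::topological_space measure) \<Rightarrow> 'a measure \<Rightarrow> bool" where
  "converges_setwise M N \<longleftrightarrow>
     (\<forall>A\<in>sets borel. (\<lambda>i. measure (M i) A) \<longlonglongrightarrow> measure N A)"

definition tv_distance :: "'a::topological_space measure \<Rightarrow> 'a measure \<Rightarrow> real" where
  "tv_distance \<mu> \<nu> = 2 * (SUP B\<in>sets borel. \<bar>measure \<mu> B - measure \<nu> B\<bar>)"

definition converges_tv :: "(nat \<Rightarrow> 'a::topological_space measure) \<Rightarrow> 'a measure \<Rightarrow> bool" where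
  "converges_tv M N \<longleftrightarrow> (\<lambda>i. tv_distance (M i) N) \<longlonglongrightarrow> 0"

text \<open>
  Compactness of a set of channels at input \<open>P\<close>, meaning sequential compactness, for a mode of
  convergence \<open>conv\<close> applied to the joint measures.
\<close>

definition compact_at_input ::
  "((nat \<Rightarrow> ('x \<times> 'y) measure) \<Rightarrow> ('x \<times> 'y) measure \<Rightarrow> bool) \<Rightarrow>
     'x::second_countable_topology measure \<Rightarrow> ('x \<Rightarrow> 'y::second_countable_topology measure) set \<Rightarrow> bool" where
  "compact_at_input conv P \<Q> \<longleftrightarrow>
     (\<forall>q :: nat \<Rightarrow> 'x \<Rightarrow> 'y measure. (\<forall>i. q i \<in> \<Q>) \<longrightarrow>
        (\<exists>Q\<in>\<Q>. \<exists>r :: nat \<Rightarrow> nat. strict_mono r \<and> conv (\<lambda>i. joint P (q (r i))) (joint P Q)))"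

text \<open>
  The suprema and infima below are real ones; the boundedness conjuncts make sure that they are
  genuine.
\<close>

definition worst_channel ::
  "'u::topological_space set \<Rightarrow> ('x \<times> 'u \<Rightarrow> real) \<Rightarrow> 'x::second_countable_topology measure \<Rightarrow>
     ('x \<Rightarrow> 'y::second_countable_topology measure) set \<Rightarrow> ('x \<Rightarrow> 'y measure) \<Rightarrow> bool" where
  "worst_channel U c P \<Q> Q\<^sub>0 \<longleftrightarrow>
     Q\<^sub>0 \<in> \<Q> \<and> bdd_above (optimal_cost U c P ` \<Q>) \<and>
     optimal_cost U c P Q\<^sub>0 = (SUP Q\<in>\<Q>. optimal_cost U c P Q)"

definition best_channel ::
  "'u::topological_space set \<Rightarrow> ('x \<times> 'u \<Rightarrow> real) \<Rightarrow> 'x::second_countable_topology measure \<Rightarrow>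
     ('x \<Rightarrow> 'y::second_countable_topology measure) set \<Rightarrow> ('x \<Rightarrow> 'y measure) \<Rightarrow> bool" where
  "best_channel U c P \<Q> Q\<^sub>0 \<longleftrightarrow>
     Q\<^sub>0 \<in> \<Q> \<and> bdd_below (optimal_cost U c P ` \<Q>) \<and>
     optimal_cost U c P Q\<^sub>0 = (INF Q\<in>\<Q>. optimal_cost U c P Q)"

end

theory Submission
  imports Defs
begin

text \<open>
  For a fixed policy \<open>\<gamma>\<close> the expected cost is the integral of \<open>(x, y) \<mapsto> c (x, \<gamma> y)\<close> against the
  joint measure, and the optimal cost is the infimum over \<open>\<gamma>\<close>. An infimum of sequentially
  continuous functions of the channel is sequentially upper semicontinuous, and an upper
  semicontinuous function attains its supremum on a sequentially compact set
  (\<open>usc_attains_sup\<close>). So a worst channel exists as soon as the infimum may be taken over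
  policies whose expected cost is continuous in the given mode of convergence.

  For setwise convergence every policy qualifies, because setwise convergence of probability
  measures already gives convergence of the integrals of bounded measurable functions
  (\<open>converges_setwise_integral\<close>).

  For weak convergence with a continuous cost, the continuous policies qualify, and they suffice:
  by Lusin's theorem a measurable policy is continuous on a closed set that carries nearly all of
  the distribution of the observation, and Dugundji's extension theorem extends it from there to
  a continuous map into the convex set \<open>U\<close> (\<open>Lusin_convex_valued\<close>). As \<open>c\<close> is bounded, changing a
  policy on a set of small probability changes the expected cost little
  (\<open>continuous_policy_approx\<close>).

  Convergence in total variation implies setwise convergence, which gives the worst channel. It
  also makes the expected costs converge uniformly over all policies
  (\<open>integral_diff_le_tv_distance\<close>), so the optimal cost is lower semicontinuous as well and a best
  channel exists.
\<close>

section \<open>Attained suprema\<close>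

text \<open>
  A maximizing sequence has a convergent subsequence, and semicontinuity bounds the supremum by the
  value at its limit. The relation \<open>conv\<close> is arbitrary because channels converge only through their
  joint measures, which do not determine them.
\<close>

lemma usc_attains_sup:
  fixes F :: "'a \<Rightarrow> real"
  assumes ne: "S \<noteq> {}" and bdd: "bdd_above (F ` S)"
    and subseq: "\<And>q :: nat \<Rightarrow> 'a. (\<And>i. q i \<in> S) \<Longrightarrow>
        \<exists>x\<in>S. \<exists>r :: nat \<Rightarrow> nat. strict_mono r \<and> conv (q \<circ> r) x"
    and usc: "\<And>q x e. (\<And>i. q i \<in> S) \<Longrightarrow> x \<in> S \<Longrightarrow> conv q x \<Longrightarrow> 0 < e \<Longrightarrow>
        \<forall>\<^sub>F i in sequentially. F (q i) \<le> F x + e"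
  shows "\<exists>x\<in>S. F x = (SUP y\<in>S. F y)"
proof -
  let ?s = "SUP y\<in>S. F y"
  have "\<exists>q. q \<in> S \<and> ?s - 1 / real (Suc i) < F q" for i
    using less_cSUP_iff[OF ne bdd, of "?s - 1 / real (Suc i)"] by auto
  then obtain q where q: "\<And>i. q i \<in> S" "\<And>i. ?s - 1 / real (Suc i) < F (q i)"
    by metis
  obtain x r where x: "x \<in> S" and r: "strict_mono r" and conv: "conv (q \<circ> r) x"
    using subseq[of q] q(1) by blast
  have "(\<lambda>i. ?s - 1 / real (Suc i)) \<longlonglongrightarrow> ?s - 0"
    by (intro tendsto_intros LIMSEQ_Suc lim_1_over_n)
  from LIMSEQ_subseq_LIMSEQ[OF this r]
  have lim: "(\<lambda>i. ?s - 1 / real (Suc (r i))) \<longlonglongrightarrow> ?s"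
    by (simp add: comp_def)
  have "?s \<le> F x + e" if "0 < e" for e
  proof (rule tendsto_upperbound[OF lim])
    have "\<forall>\<^sub>F i in sequentially. F ((q \<circ> r) i) \<le> F x + e"
      using usc[OF _ x conv that] q(1) by simp
    then show "\<forall>\<^sub>F i in sequentially. ?s - 1 / real (Suc (r i)) \<le> F x + e"
    proof eventually_elim
      case (elim i)
      then show ?case using q(2)[of "r i"] by simp
    qed
  qed simp
  then have "?s \<le> F x" by (rule field_le_epsilon)
  moreover have "F x \<le> ?s" using x bdd by (rule cSUP_upper)
  ultimately show ?thesis using x by (intro bexI[of _ x]) auto
qed

section \<open>Integrals as averages of level set measures\<close>

text \<open>
  The sum counts the multiples of \<open>1 / k\<close> in \<open>(0, t]\<close>, so the quotient is \<open>t\<close> rounded down to a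
  multiple of \<open>1 / k\<close>.
\<close>

lemma staircase_approx:
  fixes t :: real
  assumes "0 \<le> t" "t \<le> 1" "0 < k"
  shows "\<bar>t - (\<Sum>j<k. indicator {real (Suc j) / real k..} t) / real k\<bar> \<le> 1 / real k"
proof -
  have "(\<Sum>j<k. indicator {real (Suc j) / real k..} t :: real) = real (card {j\<in>{..<k}. real (Suc j) \<le> real k * t})"
    using assms by (simp add: indicator_def sum.If_cases Int_def field_simps)
  also have "{j\<in>{..<k}. real (Suc j) \<le> real k * t} = {..<nat \<lfloor>real k * t\<rfloor>}"
  proof -
    have "j < k" if "real (Suc j) \<le> real k * t" for j
    proof -
      have "real k * t \<le> real k" using assms by (simp add: mult_left_le)
      with that show ?thesis by simp
    qed
    moreover have "real (Suc j) \<le> real k * t \<longleftrightarrow> j < nat \<lfloor>real k * t\<rfloor>" for j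
      by (simp add: zless_nat_eq_int_zless) linarith
    ultimately show ?thesis by auto
  qed
  finally have "(\<Sum>j<k. indicator {real (Suc j) / real k..} t) = real (nat \<lfloor>real k * t\<rfloor>)"
    by simp
  moreover have "\<bar>real k * t - real (nat \<lfloor>real k * t\<rfloor>)\<bar> \<le> 1"
    using assms by (simp add: of_nat_nat) linarith
  moreover have "\<bar>t - real (nat \<lfloor>real k * t\<rfloor>) / real k\<bar> = \<bar>real k * t - real (nat \<lfloor>real k * t\<rfloor>)\<bar> / real k"
    using assms 
  proof -
    have "t - real (nat \<lfloor>real k * t\<rfloor>) / real k = (real k * t - real (nat \<lfloor>real k * t\<rfloor>)) / real k"
      using assms by (simp add: diff_divide_distrib)
    then show ?thesis by (simp add: abs_divide del: of_nat_nat)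
  qed
  ultimately show ?thesis using assms by (simp add: divide_right_mono)
qed

text \<open>
  A discrete layer cake formula: up to an error that does not depend on the measure, the integral is
  an average of measures of finitely many level sets. Both setwise convergence and the total
  variation distance speak about measures of sets, and this transfers them to integrals.
\<close>

lemma integral_staircase_approx:
  fixes f :: "'a::topological_space \<Rightarrow> real"
  assumes "prob_space M" and s: "sets M = sets borel" and f: "f \<in> borel_measurable borel"
    and f01: "\<And>z. 0 \<le> f z \<and> f z \<le> 1" and k: "0 < k"
  shows "\<bar>(\<integral>z. f z \<partial>M) - (\<Sum>j<k. measure M {z. real (Suc j) / real k \<le> f z}) / real k\<bar> \<le> 1 / real k"
proof -
  interpret prob_space M by fact
  have fM [measurable]: "f \<in> borel_measurable M"
    using f measurable_cong_sets[OF s refl] by blast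
  have sp: "space M = UNIV" using sets_eq_imp_space_eq[OF s] by simp
  define g where "g z = (\<Sum>j<k. indicator {real (Suc j) / real k..} (f z)) / real k" for z
  have lev: "{z. real (Suc j) / real k \<le> f z} \<in> sets M" for j
    using measurable_sets[OF fM, of "{real (Suc j) / real k..}"] by (simp add: sp vimage_def)
  have ind: "indicator {real (Suc j) / real k..} (f z) = (indicator {z. real (Suc j) / real k \<le> f z} z :: real)" for j z
    by (simp add: indicator_def)
  have g_eq: "g = (\<lambda>z. (\<Sum>j<k. indicator {z. real (Suc j) / real k \<le> f z} z) / real k)"
    by (rule ext) (simp only: g_def ind)
  have int_g: "integrable M g"
    unfolding g_eq
    by (intro integrable_divide Bochner_Integration.integrable_sum integrable_real_indicator lev)
       (simp add: emeasure_eq_measure)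
  have int_f: "integrable M f"
    using f01 by (intro integrable_const_bound[of _ 1]) auto
  have "(\<integral>z. g z \<partial>M) = (\<Sum>j<k. measure M {z. real (Suc j) / real k \<le> f z}) / real k"
    unfolding g_eq using lev by (simp add: Bochner_Integration.integral_sum emeasure_eq_measure sp)
  then have "\<bar>(\<integral>z. f z \<partial>M) - (\<Sum>j<k. measure M {z. real (Suc j) / real k \<le> f z}) / real k\<bar>
      = \<bar>\<integral>z. f z - g z \<partial>M\<bar>"
    using int_f int_g by simp
  also have "\<dots> \<le> (\<integral>z. \<bar>f z - g z\<bar> \<partial>M)"
    by (rule integral_abs_bound)
  also have "\<dots> \<le> (\<integral>z. 1 / real k \<partial>M)"
    using int_f int_g f01 k unfolding g_def
    by (intro integral_mono staircase_approx) (auto simp: g_def[symmetric])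
  also have "\<dots> = 1 / real k" by (simp add: prob_space)
  finally show ?thesis .
qed

lemma integral_diff_staircase:
  fixes f :: "'a::topological_space \<Rightarrow> real"
  assumes "prob_space M" "sets M = sets borel" "prob_space N" "sets N = sets borel"
    and "f \<in> borel_measurable borel" "\<And>z. 0 \<le> f z \<and> f z \<le> B" "0 < B" "0 < k"
  shows "\<bar>(\<integral>z. f z \<partial>M) - (\<integral>z. f z \<partial>N)\<bar>
    \<le> B * (2 / real k + (\<Sum>j<k. \<bar>measure M {z. real (Suc j) / real k \<le> f z / B}
                                - measure N {z. real (Suc j) / real k \<le> f z / B}\<bar>) / real k)"
proof -
  let ?S = "\<lambda>M. (\<Sum>j<k. measure M {z. real (Suc j) / real k \<le> f z / B}) / real k"
  let ?D = "(\<Sum>j<k. \<bar>measure M {z. real (Suc j) / real k \<le> f z / B}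
                      - measure N {z. real (Suc j) / real k \<le> f z / B}\<bar>) / real k"
  have m: "(\<lambda>z. f z / B) \<in> borel_measurable borel" using assms(5) by measurable
  have b: "0 \<le> f z / B \<and> f z / B \<le> 1" for z using assms(6)[of z] assms(7) by simp
  have "\<bar>?S M - ?S N\<bar> \<le> ?D"
    using assms(8) unfolding diff_divide_distrib[symmetric] sum_subtractf[symmetric] abs_divide
    by (simp add: divide_right_mono)
  moreover have "\<bar>(\<integral>z. f z / B \<partial>M) - ?S M\<bar> \<le> 1 / real k"
    by (rule integral_staircase_approx[OF assms(1,2) m b assms(8)])
  moreover have "\<bar>(\<integral>z. f z / B \<partial>N) - ?S N\<bar> \<le> 1 / real k"
    by (rule integral_staircase_approx[OF assms(3,4) m b assms(8)])
  ultimately have "\<bar>(\<integral>z. f z / B \<partial>M) - (\<integral>z. f z / B \<partial>N)\<bar> \<le> 2 / real k + ?D"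
    by linarith
  then have "B * \<bar>((\<integral>z. f z \<partial>M) - (\<integral>z. f z \<partial>N)) / B\<bar> \<le> B * (2 / real k + ?D)"
    using assms(7) by (intro mult_left_mono) (auto simp: diff_divide_distrib)
  then show ?thesis using assms(7) by simp
qed

lemma converges_setwise_integral:
  fixes f :: "'a::topological_space \<Rightarrow> real"
  assumes conv: "converges_setwise M N"
    and M: "\<And>i. prob_space (M i)" "\<And>i. sets (M i) = sets borel"
    and N: "prob_space N" "sets N = sets borel"
    and f: "f \<in> borel_measurable borel" "\<And>z. 0 \<le> f z \<and> f z \<le> B" and B: "0 < B"
  shows "(\<lambda>i. \<integral>z. f z \<partial>M i) \<longlonglongrightarrow> (\<integral>z. f z \<partial>N)"
proof (rule LIMSEQ_I)
  fix e :: real assume e: "0 < e"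
  define k where "k = Suc (nat \<lceil>4 * B / e\<rceil>)"
  have k: "0 < k" "B * (2 / real k) \<le> e / 2"
  proof -
    have "4 * B / e \<le> real k" unfolding k_def by linarith
    then have "4 * B \<le> real k * e" using e by (simp add: field_simps)
    then show "B * (2 / real k) \<le> e / 2"
      by (simp add: k_def field_simps)
  qed (simp add: k_def)
  define A where "A j = {z. real (Suc j) / real k \<le> f z / B}" for j
  have A: "A j \<in> sets borel" for j
    unfolding A_def using f(1) by measurable
  have "(\<lambda>i. \<bar>measure (M i) (A j) - measure N (A j)\<bar>) \<longlonglongrightarrow> \<bar>measure N (A j) - measure N (A j)\<bar>" for j
    using conv A unfolding converges_setwise_def by (intro tendsto_intros) auto
  then have "(\<lambda>i. B * ((\<Sum>j<k. \<bar>measure (M i) (A j) - measure N (A j)\<bar>) / real k))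
       \<longlonglongrightarrow> B * ((\<Sum>j<k. 0) / real k)"
    using k by (intro tendsto_intros) auto
  then have "\<forall>\<^sub>F i in sequentially. B * ((\<Sum>j<k. \<bar>measure (M i) (A j) - measure N (A j)\<bar>) / real k) < e / 2"
    using e by (intro order_tendstoD(2)) auto
  then have "\<forall>\<^sub>F i in sequentially. norm ((\<integral>z. f z \<partial>M i) - (\<integral>z. f z \<partial>N)) < e"
  proof eventually_elim
    case (elim i)
    then show ?case
      using integral_diff_staircase[OF M(1,2)[of i] N f B k(1), folded A_def] k(2)
      unfolding distrib_left real_norm_def by linarith
  qed
  then show "\<exists>no. \<forall>n\<ge>no. norm ((\<integral>z. f z \<partial>M n) - (\<integral>z. f z \<partial>N)) < e"
    by (simp add: eventually_sequentially)
qed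

lemma measure_diff_le_tv_distance:
  assumes "prob_space M" "prob_space N" "A \<in> sets borel"
  shows "\<bar>measure M A - measure N A\<bar> \<le> tv_distance M N / 2"
proof -
  interpret M: prob_space M by fact
  interpret N: prob_space N by fact
  have "bdd_above ((\<lambda>B. \<bar>measure M B - measure N B\<bar>) ` sets borel)"
  proof (rule bdd_aboveI2)
    fix B show "\<bar>measure M B - measure N B\<bar> \<le> 1"
      using M.prob_le_1[of B] N.prob_le_1[of B] measure_nonneg[of M B] measure_nonneg[of N B] by linarith
  qed
  then show ?thesis
    using assms(3) unfolding tv_distance_def by (auto intro: cSUP_upper)
qed

lemma converges_tv_imp_setwise:
  assumes conv: "converges_tv M N" and "\<And>i. prob_space (M i)" "prob_space N"
  shows "converges_setwise M N"
  unfolding converges_setwise_def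
proof
  fix A :: "'a set" assume A: "A \<in> sets borel"
  have "(\<lambda>i. measure (M i) A - measure N A) \<longlonglongrightarrow> 0"
  proof (rule Lim_null_comparison)
    show "\<forall>\<^sub>F i in sequentially. norm (measure (M i) A - measure N A) \<le> tv_distance (M i) N / 2"
      using measure_diff_le_tv_distance[OF assms(2,3) A] by simp
    show "(\<lambda>i. tv_distance (M i) N / 2) \<longlonglongrightarrow> 0"
      using tendsto_divide[OF conv[unfolded converges_tv_def] tendsto_const[of 2]] by simp
  qed
  then show "(\<lambda>i. measure (M i) A) \<longlonglongrightarrow> measure N A"
    by (simp add: LIM_zero_iff)
qed

text \<open>
  The level sets in the staircase depend on \<open>k\<close>, but the total variation distance bounds all of them
  at once, so the staircase error can be sent to 0.
\<close>

lemma integral_diff_le_tv_distance: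
  fixes f :: "'a::topological_space \<Rightarrow> real"
  assumes M: "prob_space M" "sets M = sets borel" and N: "prob_space N" "sets N = sets borel"
    and f: "f \<in> borel_measurable borel" "\<And>z. 0 \<le> f z \<and> f z \<le> B" and B: "0 < B"
  shows "\<bar>(\<integral>z. f z \<partial>M) - (\<integral>z. f z \<partial>N)\<bar> \<le> B * (tv_distance M N / 2)"
proof (rule LIMSEQ_le_const)
  show "(\<lambda>k. B * (2 / real k + tv_distance M N / 2)) \<longlonglongrightarrow> B * (tv_distance M N / 2)"
  proof -
    have "(\<lambda>k. B * (2 / real k + tv_distance M N / 2)) \<longlonglongrightarrow> B * (0 + tv_distance M N / 2)"
      by (intro tendsto_intros lim_const_over_n)
    then show ?thesis by simp
  qed
  show "\<exists>K. \<forall>k\<ge>K. \<bar>(\<integral>z. f z \<partial>M) - (\<integral>z. f z \<partial>N)\<bar> \<le> B * (2 / real k + tv_distance M N / 2)"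
  proof (intro exI[of _ 1] allI impI)
    fix k :: nat assume k: "1 \<le> k"
    define A where "A j = {z. real (Suc j) / real k \<le> f z / B}" for j
    have A: "A j \<in> sets borel" for j
      unfolding A_def using f(1) by measurable
    have "(\<Sum>j<k. \<bar>measure M (A j) - measure N (A j)\<bar>) \<le> real (card {..<k}) * (tv_distance M N / 2)"
      by (intro sum_bounded_above measure_diff_le_tv_distance M N A)
    then have "(\<Sum>j<k. \<bar>measure M (A j) - measure N (A j)\<bar>) / real k \<le> tv_distance M N / 2"
      using k by (simp add: field_simps)
    then have "B * (2 / real k + (\<Sum>j<k. \<bar>measure M (A j) - measure N (A j)\<bar>) / real k)
        \<le> B * (2 / real k + tv_distance M N / 2)"
      using B by (intro mult_left_mono) auto
    with integral_diff_staircase[OF M N f B, of k] k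
    show "\<bar>(\<integral>z. f z \<partial>M) - (\<integral>z. f z \<partial>N)\<bar> \<le> B * (2 / real k + tv_distance M N / 2)"
      unfolding A_def by (meson less_le_trans order_trans zero_less_one)
  qed
qed

section \<open>Lusin's theorem\<close>

lemma open_superset_measure_diff_less:
  fixes M :: "'a::{second_countable_topology, complete_space} measure"
  assumes "finite_measure M" and s: "sets M = sets borel" and A: "A \<in> sets borel" and e: "0 < e"
  obtains V where "open V" "A \<subseteq> V" "measure M (V - A) < e"
proof -
  interpret finite_measure M by fact
  have reg: "emeasure M A = (INF V \<in> {V. A \<subseteq> V \<and> open V}. emeasure M V)"
    by (rule outer_regular[OF s _ A]) simp
  have "emeasure M A < ennreal (measure M A + e)"
    using e by (simp add: emeasure_eq_measure ennreal_less_iff)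
  from this[unfolded reg INF_less_iff]
  obtain V where V: "A \<subseteq> V" "open V" "emeasure M V < ennreal (measure M A + e)"
    by blast
  then have "measure M V < measure M A + e"
    by (simp add: emeasure_eq_measure ennreal_less_iff del: ennreal_plus)
  moreover have "measure M (V - A) = measure M V - measure M A"
    using V A s by (intro finite_measure_Diff) auto
  ultimately show thesis using V that by simp
qed

text \<open>
  Each preimage of a basic open set is squeezed between the closed set \<open>- W i\<close> and the open set
  \<open>V i\<close>, up to a small measure. Off the gaps \<open>V i \<inter> W i\<close> these preimages are relatively open, which
  is continuity, and the gaps are open, so what remains is closed.
\<close>

theorem Lusin:
  fixes f :: "'a::{second_countable_topology, complete_space} \<Rightarrow> 'b::second_countable_topology"
  assumes "finite_measure M" and s: "sets M = sets borel"
    and f: "f \<in> borel_measurable borel" and e: "0 < e"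
  obtains K where "closed K" "continuous_on K f" "measure M (- K) \<le> e"
proof -
  interpret finite_measure M by fact
  obtain \<B> :: "'b set set" where "countable \<B>" and basis: "topological_basis \<B>"
    using ex_countable_basis by blast
  have "\<B> \<noteq> {}"
    using basis unfolding topological_basis_def by (metis open_UNIV UNIV_not_empty Sup_empty subset_empty)
  define b where "b = from_nat_into \<B>"
  have b: "range b = \<B>"
    unfolding b_def using \<open>\<B> \<noteq> {}\<close> \<open>countable \<B>\<close> by (rule range_from_nat_into)
  have ob: "open (b i)" for i
    using b basis topological_basis_open by blast
  \<comment> \<open>Each gap consists of an outer and an inner error below \<open>d i\<close>; all gaps together have measure
    at most \<open>\<Sum>i. 2 * d i = e\<close>.\<close>
  define d where "d i = e * (1/2) ^ Suc (Suc i)" for i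
  have d: "0 < d i" for i using e by (simp add: d_def)
  have meas: "f -` b i \<in> sets borel" for i
    using measurable_sets[OF f, of "b i"] ob by simp
  have "\<exists>V. open V \<and> f -` b i \<subseteq> V \<and> measure M (V - f -` b i) < d i" for i
    using open_superset_measure_diff_less[OF \<open>finite_measure M\<close> s meas d] by metis
  then obtain V where V: "\<And>i. open (V i)" "\<And>i. f -` b i \<subseteq> V i" "\<And>i. measure M (V i - f -` b i) < d i"
    by metis
  \<comment> \<open>Inner approximation by a closed set is outer approximation of the complement.\<close>
  have "\<exists>W. open W \<and> - (f -` b i) \<subseteq> W \<and> measure M (W - - (f -` b i)) < d i" for i
    using open_superset_measure_diff_less[OF \<open>finite_measure M\<close> s borel_comp[OF meas] d] by metis
  then obtain W where W: "\<And>i. open (W i)" "\<And>i. - (f -` b i) \<subseteq> W i"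
      "\<And>i. measure M (W i - - (f -` b i)) < d i"
    by metis
  define K where "K = - (\<Union>i. V i \<inter> W i)"
  have oVW: "open (V i \<inter> W i)" for i using V(1) W(1) by (rule open_Int)
  show thesis
  proof (rule that)
    show "closed K" unfolding K_def using oVW by (intro closed_Compl open_UN) auto
    show "continuous_on K f"
      unfolding continuous_on_open_invariant
    proof (intro allI impI)
      fix T :: "'b set" assume "open T"
      then obtain \<C> where \<C>: "\<C> \<subseteq> \<B>" "\<Union>\<C> = T"
        using basis unfolding topological_basis_def by blast
      have pre: "V i \<inter> K = f -` b i \<inter> K" for i
        using V(2)[of i] W(2)[of i] unfolding K_def by blast
      have "T = (\<Union>i\<in>{i. b i \<in> \<C>}. b i)"
        using \<C> b by blast
      then have "(\<Union>i\<in>{i. b i \<in> \<C>}. V i) \<inter> K = f -` T \<inter> K"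
        using pre by (simp only: vimage_UN Int_UN_distrib2) auto
      moreover have "open (\<Union>i\<in>{i. b i \<in> \<C>}. V i)" using V(1) by blast
      ultimately show "\<exists>A. open A \<and> A \<inter> K = f -` T \<inter> K" by blast
    qed
    have le: "measure M (V i \<inter> W i) \<le> e * (1/2) ^ Suc i" for i
    proof -
      have VB: "V i - f -` b i \<in> sets M" "W i - - (f -` b i) \<in> sets M"
        using V(1)[of i] W(1)[of i] meas[of i] s by auto
      have "measure M (V i \<inter> W i) \<le> measure M ((V i - f -` b i) \<union> (W i - - (f -` b i)))"
        using VB by (intro finite_measure_mono) auto
      also have "\<dots> \<le> measure M (V i - f -` b i) + measure M (W i - - (f -` b i))"
        using VB by (rule measure_Un_le)
      also have "\<dots> \<le> e * (1/2) ^ Suc i"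
        using V(3)[of i] W(3)[of i] by (simp add: d_def)
      finally show ?thesis .
    qed
    have sums: "(\<lambda>i. e * (1/2) ^ Suc i) sums (e * 1)"
      by (intro sums_mult power_half_series)
    have summable: "summable (\<lambda>i. measure M (V i \<inter> W i))"
      by (rule summable_comparison_test'[OF sums_summable[OF sums]]) (use le in simp)
    have "measure M (- K) \<le> (\<Sum>i. measure M (V i \<inter> W i))"
      unfolding K_def double_complement using oVW s summable
      by (intro finite_measure_subadditive_countably) auto
    also have "\<dots> \<le> (\<Sum>i. e * (1/2) ^ Suc i)"
      by (intro suminf_le le summable sums_summable[OF sums])
    also have "\<dots> = e" using sums_unique[OF sums] by simp
    finally show "measure M (- K) \<le> e" .
  qed
qed

corollary Lusin_convex_valued:
  fixes f :: "'a::{second_countable_topology, complete_space} \<Rightarrow> 'b::{real_inner, second_countable_topology}"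
  assumes M: "finite_measure M" "sets M = sets borel"
    and f: "f \<in> borel_measurable borel" and U: "convex U" "U \<noteq> {}" "\<And>x. f x \<in> U" and e: "0 < e"
  obtains g where "continuous_on UNIV g" "\<And>x. g x \<in> U" "measure M {x. g x \<noteq> f x} \<le> e"
proof -
  interpret finite_measure M by fact
  obtain K where K: "closed K" "continuous_on K f" "measure M (- K) \<le> e"
    using Lusin[OF M f e] .
  obtain g where g: "continuous_on UNIV g" "g ` UNIV \<subseteq> U" "\<And>x. x \<in> K \<Longrightarrow> g x = f x"
    by (rule Dugundji[OF U(1,2), of UNIV K f]) (use K U in auto)
  have "measure M {x. g x \<noteq> f x} \<le> measure M (- K)"
    using g(3) K(1) M(2) by (intro finite_measure_mono) auto
  also note K(3)
  finally show thesis using that g(1,2) by blast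
qed

section \<open>Expected costs of policies\<close>

lemma joint_is_prob:
  fixes Q :: "'x::second_countable_topology \<Rightarrow> 'y::second_countable_topology measure"
  assumes P: "prob_space P" "sets P = sets borel" and Q: "is_channel Q"
  shows sets_joint: "sets (joint P Q) = sets borel" and prob_space_joint: "prob_space (joint P Q)"
proof -
  show s: "sets (joint P Q) = sets borel"
    unfolding joint_def using prob_space.not_empty[OF P(1)] by (intro sets_bind) auto
  have "emeasure (joint P Q) (space (joint P Q)) = (\<integral>\<^sup>+ x. emeasure (Q x) UNIV \<partial>P)"
    using emeasure_joint[OF P Q, of UNIV] sets_eq_imp_space_eq[OF s] by simp
  also have "\<dots> = (\<integral>\<^sup>+ x. 1 \<partial>P)"
  proof (rule nn_integral_cong)
    fix x
    have Qx: "prob_space (Q x)" "sets (Q x) = sets borel" using Q by (auto simp: is_channel_iff)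
    then show "emeasure (Q x) UNIV = 1"
      using prob_space.emeasure_space_1[OF Qx(1)] sets_eq_imp_space_eq[OF Qx(2)] by simp
  qed
  also have "\<dots> = 1" using prob_space.emeasure_space_1[OF P(1)] by simp
  finally show "prob_space (joint P Q)" by (rule prob_spaceI)
qed

lemma policies_iff:
  "\<gamma> \<in> policies U \<longleftrightarrow> \<gamma> \<in> borel_measurable borel \<and> (\<forall>y. \<gamma> y \<in> U)"
  unfolding policies_def measurable_restrict_space2_iff by auto

lemma policy_cost_measurable:
  fixes \<gamma> :: "'y::second_countable_topology \<Rightarrow> 'u::second_countable_topology"
    and c :: "'x::second_countable_topology \<times> 'u \<Rightarrow> real"
  assumes c: "c \<in> borel_measurable (restrict_space borel (UNIV \<times> U))" and \<gamma>: "\<gamma> \<in> policies U"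
  shows "(\<lambda>(x, y). c (x, \<gamma> y)) \<in> borel_measurable borel"
proof -
  have [measurable]: "\<gamma> \<in> borel_measurable borel" using \<gamma> by (simp add: policies_iff)
  have "(\<lambda>z::'x \<times> 'y. (fst z, \<gamma> (snd z))) \<in> borel \<rightarrow>\<^sub>M restrict_space borel (UNIV \<times> U)"
    unfolding measurable_restrict_space2_iff borel_prod[symmetric] using \<gamma> by (auto simp: policies_iff)
  from measurable_compose[OF this c] show ?thesis by (simp add: case_prod_beta)
qed

lemma constant_policy:
  assumes "u \<in> U"
  shows "(\<lambda>_. u) \<in> policies U"
  using assms by (simp add: policies_iff)

lemma policy_cost_bounds:
  assumes "\<forall>z\<in>UNIV \<times> U. 0 \<le> c z \<and> c z \<le> B" and "\<gamma> \<in> policies U"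
  shows "0 \<le> (case z of (x, y) \<Rightarrow> c (x, \<gamma> y)) \<and> (case z of (x, y) \<Rightarrow> c (x, \<gamma> y)) \<le> (B::real)"
  using assms by (auto simp: policies_iff split: prod.split)

lemma optimal_cost_le:
  fixes Q :: "'x::second_countable_topology \<Rightarrow> 'y::second_countable_topology measure"
  assumes "\<forall>z\<in>UNIV \<times> U. 0 \<le> c z" and "\<gamma> \<in> policies U"
  shows "optimal_cost U c P Q \<le> (\<integral>(x, y). c (x, \<gamma> y) \<partial>joint P Q)"
  unfolding optimal_cost_def
proof (rule cINF_lower[OF bdd_belowI2 assms(2)])
  fix \<gamma> :: "'y \<Rightarrow> _" assume "\<gamma> \<in> policies U"
  then show "0 \<le> (\<integral>(x, y). c (x, \<gamma> y) \<partial>joint P Q)"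
    using assms(1) by (intro Bochner_Integration.integral_nonneg) (auto simp: policies_iff)
qed

lemma optimal_cost_bounds:
  fixes Q :: "'x::second_countable_topology \<Rightarrow> 'y::second_countable_topology measure"
    and U :: "'u::second_countable_topology set"
  assumes P: "prob_space P" "sets P = sets borel" and Q: "is_channel Q" and U: "U \<noteq> {}"
    and c: "\<forall>z\<in>UNIV \<times> U. 0 \<le> c z \<and> c z \<le> B"
    and cm: "c \<in> borel_measurable (restrict_space borel (UNIV \<times> U))"
  shows "0 \<le> optimal_cost U c P Q \<and> optimal_cost U c P Q \<le> B"
proof
  interpret J: prob_space "joint P Q" by (rule prob_space_joint[OF P Q])
  obtain u where "u \<in> U" using U by blast
  then have pol: "(\<lambda>_. u) \<in> policies U" by (rule constant_policy)
  show "0 \<le> optimal_cost U c P Q"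
    unfolding optimal_cost_def
  proof (rule cINF_greatest)
    fix \<gamma> :: "'y \<Rightarrow> 'u" assume "\<gamma> \<in> policies U"
    then show "0 \<le> (\<integral>(x, y). c (x, \<gamma> y) \<partial>joint P Q)"
      using c by (intro Bochner_Integration.integral_nonneg) (auto simp: policies_iff)
  qed (use pol in blast)
  have "(\<lambda>(x, y). c (x, u)) \<in> borel_measurable (joint P Q)"
    using policy_cost_measurable[OF cm pol] measurable_cong_sets[OF sets_joint[OF P Q] refl] by blast
  then have "(\<integral>(x, y). c (x, u) \<partial>joint P Q) \<le> B"
    using policy_cost_bounds[OF c pol]
    by (intro J.integral_le_const J.integrable_const_bound[of _ B]) (auto simp: case_prod_beta')
  moreover have "optimal_cost U c P Q \<le> (\<integral>(x, y). c (x, u) \<partial>joint P Q)"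
    using c by (intro optimal_cost_le[OF _ pol]) auto
  ultimately show "optimal_cost U c P Q \<le> B" by simp
qed

text \<open>
  The competitor \<open>\<gamma>'\<close> may cost slightly more than \<open>\<gamma>\<close>. This slack lets the infimum be taken over a
  smaller class of policies, such as the continuous ones, on which the expected cost is continuous
  along the sequence.
\<close>

lemma optimal_cost_usc:
  fixes U :: "'u::topological_space set"
    and Q :: "'x::second_countable_topology \<Rightarrow> 'y::second_countable_topology measure"
  assumes U: "U \<noteq> {}" and c: "\<forall>z\<in>UNIV \<times> U. 0 \<le> c z"
    and test: "\<And>\<gamma> d. \<gamma> \<in> policies U \<Longrightarrow> 0 < d \<Longrightarrow> \<exists>\<gamma>'\<in>policies U.
        (\<integral>(x, y). c (x, \<gamma>' y) \<partial>joint P Q) \<le> (\<integral>(x, y). c (x, \<gamma> y) \<partial>joint P Q) + d \<and>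
        (\<lambda>i. \<integral>(x, y). c (x, \<gamma>' y) \<partial>joint P (q i)) \<longlonglongrightarrow> (\<integral>(x, y). c (x, \<gamma>' y) \<partial>joint P Q)"
    and e: "0 < e"
  shows "\<forall>\<^sub>F i in sequentially. optimal_cost U c P (q i) \<le> optimal_cost U c P Q + e"
proof -
  let ?I = "\<lambda>\<gamma> Q. \<integral>(x, y). c (x, \<gamma> y) \<partial>joint P Q"
  have bdd: "bdd_below ((\<lambda>\<gamma>. ?I \<gamma> Q) ` policies U)"
    using c by (intro bdd_belowI2[of _ 0] Bochner_Integration.integral_nonneg) (auto simp: policies_iff)
  have ne: "policies U \<noteq> ({} :: ('y \<Rightarrow> 'u) set)"
    using U constant_policy by blast
  have "\<exists>\<gamma>\<in>policies U. ?I \<gamma> Q < optimal_cost U c P Q + e / 3"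
    using cINF_less_iff[OF ne bdd, of "optimal_cost U c P Q + e / 3"] e
    unfolding optimal_cost_def by simp
  then obtain \<gamma> where \<gamma>: "\<gamma> \<in> policies U" "?I \<gamma> Q < optimal_cost U c P Q + e / 3" by blast
  obtain \<gamma>' where \<gamma>': "\<gamma>' \<in> policies U" "?I \<gamma>' Q \<le> ?I \<gamma> Q + e / 3"
      "(\<lambda>i. ?I \<gamma>' (q i)) \<longlonglongrightarrow> ?I \<gamma>' Q"
    using test[OF \<gamma>(1), of "e / 3"] e by auto
  have "\<forall>\<^sub>F i in sequentially. ?I \<gamma>' (q i) < ?I \<gamma>' Q + e / 3"
    using \<gamma>'(3) e by (intro order_tendstoD(2)) auto
  then show ?thesis
  proof eventually_elim
    case (elim i)
    have "optimal_cost U c P (q i) \<le> ?I \<gamma>' (q i)"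
      using c \<gamma>'(1) by (rule optimal_cost_le)
    with elim \<gamma>(2) \<gamma>'(2) show ?case by linarith
  qed
qed

text \<open>
  Lusin's theorem is applied to the marginal of the joint measure on the observations. The integrands
  for the two policies agree except where the observation lies in an exceptional set of probability
  at most \<open>d / B\<close>, and there they differ by at most \<open>B\<close>.
\<close>

lemma continuous_policy_approx:
  fixes Q :: "'x::second_countable_topology \<Rightarrow> 'y::{second_countable_topology, complete_space} measure"
    and U :: "'u::{real_inner, second_countable_topology} set"
  assumes P: "prob_space P" "sets P = sets borel" and Q: "is_channel Q"
    and U: "convex U" "U \<noteq> {}"
    and c: "\<forall>z\<in>UNIV \<times> U. 0 \<le> c z \<and> c z \<le> B" and B: "0 < B"
    and cm: "c \<in> borel_measurable (restrict_space borel (UNIV \<times> U))"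
    and \<gamma>: "\<gamma> \<in> policies U" and d: "0 < (d::real)"
  shows "\<exists>\<gamma>'\<in>policies U. continuous_on UNIV \<gamma>' \<and>
    (\<integral>(x, y). c (x, \<gamma>' y) \<partial>joint P Q) \<le> (\<integral>(x, y). c (x, \<gamma> y) \<partial>joint P Q) + d"
proof -
  let ?J = "joint P Q"
  interpret J: prob_space ?J by (rule prob_space_joint[OF P Q])
  have sJ: "sets ?J = sets borel" by (rule sets_joint[OF P Q])
  have spJ: "space ?J = UNIV" using sets_eq_imp_space_eq[OF sJ] by simp
  have snd_m: "snd \<in> ?J \<rightarrow>\<^sub>M (borel :: 'y measure)"
  proof -
    have "snd \<in> (borel :: ('x \<times> 'y) measure) \<rightarrow>\<^sub>M borel"
      by (intro borel_measurable_continuous_onI continuous_intros)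
    then show ?thesis using measurable_cong_sets[OF sJ refl] by blast
  qed
  define \<mu> where "\<mu> = distr ?J borel snd"
  have "finite_measure \<mu>"
    unfolding \<mu>_def using J.prob_space_distr[OF snd_m] by (rule prob_space.finite_measure)
  moreover have "sets \<mu> = sets borel" by (simp add: \<mu>_def)
  ultimately obtain g where g: "continuous_on UNIV g" "\<And>y. g y \<in> U" "measure \<mu> {y. g y \<noteq> \<gamma> y} \<le> d / B"
    using Lusin_convex_valued[of \<mu> \<gamma> U "d / B"] \<gamma> U d B unfolding policies_iff by (metis divide_pos_pos)
  have gm: "g \<in> borel_measurable borel" using g(1) by (rule borel_measurable_continuous_onI)
  have \<gamma>m: "\<gamma> \<in> borel_measurable borel" using \<gamma> by (simp add: policies_iff)
  have gp: "g \<in> policies U" using gm g(2) by (simp add: policies_iff)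
  define N where "N = {y. g y \<noteq> \<gamma> y}"
  have N: "N \<in> sets borel"
  proof -
    have "{y \<in> space borel. g y \<noteq> \<gamma> y} \<in> sets borel"
      using gm \<gamma>m by measurable
    then show ?thesis by (simp add: N_def)
  qed
  have NJ: "snd -` N \<in> sets ?J"
    using measurable_sets[OF snd_m N] by (simp add: spJ)
  have mN: "measure ?J (snd -` N) \<le> d / B"
    using g(3) measure_distr[OF snd_m N] by (simp add: \<mu>_def N_def[symmetric] spJ)
  have int: "integrable ?J (\<lambda>(x, y). c (x, \<delta> y))" if \<delta>: "\<delta> \<in> policies U" for \<delta>
    using policy_cost_measurable[OF cm \<delta>] measurable_cong_sets[OF sJ refl] policy_cost_bounds[OF c \<delta>]
    by (intro J.integrable_const_bound[of _ B]) (auto simp: case_prod_beta')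
  have intN: "integrable ?J (\<lambda>z. B * indicator (snd -` N) z)"
    using NJ by (intro integrable_mult_right integrable_real_indicator) (auto simp: J.emeasure_eq_measure)
  have "(\<integral>(x, y). c (x, g y) \<partial>?J) \<le> (\<integral>z. (case z of (x, y) \<Rightarrow> c (x, \<gamma> y)) + B * indicator (snd -` N) z \<partial>?J)"
  proof (rule integral_mono[OF int[OF gp] Bochner_Integration.integrable_add[OF int[OF \<gamma>] intN]])
    fix z :: "'x \<times> 'y"
    show "(case z of (x, y) \<Rightarrow> c (x, g y)) \<le> (case z of (x, y) \<Rightarrow> c (x, \<gamma> y)) + B * indicator (snd -` N) z"
      using policy_cost_bounds[OF c gp, of z] policy_cost_bounds[OF c \<gamma>, of z] B
      by (cases "g (snd z) = \<gamma> (snd z)") (auto simp: N_def split_beta)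
  qed
  also have "\<dots> = (\<integral>(x, y). c (x, \<gamma> y) \<partial>?J) + B * measure ?J (snd -` N)"
    using int[OF \<gamma>] intN NJ by (simp add: spJ)
  also have "\<dots> \<le> (\<integral>(x, y). c (x, \<gamma> y) \<partial>?J) + d"
    using mN B by (simp add: field_simps)
  finally show ?thesis using gp g(1) by blast
qed

section \<open>Semicontinuity of the optimal cost\<close>

lemma optimal_cost_usc_weakly:
  fixes Q :: "'x::second_countable_topology \<Rightarrow> 'y::{second_countable_topology, complete_space} measure"
    and U :: "'u::{real_inner, second_countable_topology} set"
  assumes P: "prob_space P" "sets P = sets borel" and Q: "is_channel Q"
    and U: "convex U" "U \<noteq> {}"
    and c: "\<forall>z\<in>UNIV \<times> U. 0 \<le> c z \<and> c z \<le> B" and B: "0 < B"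
    and cc: "continuous_on (UNIV \<times> U) c"
    and conv: "converges_weakly (\<lambda>i. joint P (q i)) (joint P Q)" and e: "0 < e"
  shows "\<forall>\<^sub>F i in sequentially. optimal_cost U c P (q i) \<le> optimal_cost U c P Q + e"
proof (rule optimal_cost_usc[OF U(2) _ _ e])
  fix \<gamma> :: "'y \<Rightarrow> 'u" and d :: real assume \<gamma>: "\<gamma> \<in> policies U" and d: "0 < d"
  obtain g where g: "g \<in> policies U" "continuous_on UNIV g"
    "(\<integral>(x, y). c (x, g y) \<partial>joint P Q) \<le> (\<integral>(x, y). c (x, \<gamma> y) \<partial>joint P Q) + d"
    using continuous_policy_approx[OF P Q U c B borel_measurable_continuous_on_restrict[OF cc] \<gamma> d] by blast
  have "continuous_on UNIV (\<lambda>z::'x \<times> 'y. (fst z, g (snd z)))"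
    by (intro continuous_intros continuous_on_compose2[OF g(2)]) auto
  then have "continuous_on UNIV (\<lambda>z::'x \<times> 'y. c (fst z, g (snd z)))"
    by (rule continuous_on_compose2[OF cc]) (use g(1) in \<open>auto simp: policies_iff\<close>)
  moreover have "bounded (range (\<lambda>(x::'x, y). c (x, g y)))"
    using policy_cost_bounds[OF c g(1)] by (intro boundedI[of _ B]) auto
  ultimately have "(\<lambda>i. \<integral>(x, y). c (x, g y) \<partial>joint P (q i)) \<longlonglongrightarrow> (\<integral>(x, y). c (x, g y) \<partial>joint P Q)"
    using conv unfolding converges_weakly_def by (simp add: split_beta)
  with g show "\<exists>\<gamma>'\<in>policies U.
      (\<integral>(x, y). c (x, \<gamma>' y) \<partial>joint P Q) \<le> (\<integral>(x, y). c (x, \<gamma> y) \<partial>joint P Q) + d \<and>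
      (\<lambda>i. \<integral>(x, y). c (x, \<gamma>' y) \<partial>joint P (q i)) \<longlonglongrightarrow> (\<integral>(x, y). c (x, \<gamma>' y) \<partial>joint P Q)"
    by blast
qed (use c in blast)

lemma optimal_cost_usc_setwise:
  fixes Q :: "'x::second_countable_topology \<Rightarrow> 'y::second_countable_topology measure"
    and U :: "'u::second_countable_topology set"
  assumes P: "prob_space P" "sets P = sets borel" and Q: "is_channel Q" "\<And>i. is_channel (q i)"
    and U: "U \<noteq> {}"
    and c: "\<forall>z\<in>UNIV \<times> U. 0 \<le> c z \<and> c z \<le> B" and B: "0 < B"
    and cm: "c \<in> borel_measurable (restrict_space borel (UNIV \<times> U))"
    and conv: "converges_setwise (\<lambda>i. joint P (q i)) (joint P Q)" and e: "0 < e"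
  shows "\<forall>\<^sub>F i in sequentially. optimal_cost U c P (q i) \<le> optimal_cost U c P Q + e"
proof (rule optimal_cost_usc[OF U _ _ e])
  fix \<gamma> :: "'y \<Rightarrow> 'u" and d :: real assume \<gamma>: "\<gamma> \<in> policies U" and d: "0 < d"
  have "(\<lambda>i. \<integral>(x, y). c (x, \<gamma> y) \<partial>joint P (q i)) \<longlonglongrightarrow> (\<integral>(x, y). c (x, \<gamma> y) \<partial>joint P Q)"
    by (rule converges_setwise_integral[OF conv prob_space_joint[OF P Q(2)] sets_joint[OF P Q(2)]
          prob_space_joint[OF P Q(1)] sets_joint[OF P Q(1)] policy_cost_measurable[OF cm \<gamma>]
          policy_cost_bounds[OF c \<gamma>] B])
  with \<gamma> d show "\<exists>\<gamma>'\<in>policies U.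
      (\<integral>(x, y). c (x, \<gamma>' y) \<partial>joint P Q) \<le> (\<integral>(x, y). c (x, \<gamma> y) \<partial>joint P Q) + d \<and>
      (\<lambda>i. \<integral>(x, y). c (x, \<gamma>' y) \<partial>joint P (q i)) \<longlonglongrightarrow> (\<integral>(x, y). c (x, \<gamma>' y) \<partial>joint P Q)"
    by (intro bexI[of _ \<gamma>]) auto
qed (use c in blast)

text \<open>
  Unlike upper semicontinuity, this needs the expected costs to converge uniformly over all policies:
  the nearly optimal policy for \<open>q i\<close> changes with \<open>i\<close>.
\<close>

lemma optimal_cost_lsc_tv:
  fixes Q :: "'x::second_countable_topology \<Rightarrow> 'y::second_countable_topology measure"
    and U :: "'u::second_countable_topology set"
  assumes P: "prob_space P" "sets P = sets borel" and Q: "is_channel Q" "\<And>i. is_channel (q i)"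
    and U: "U \<noteq> {}"
    and c: "\<forall>z\<in>UNIV \<times> U. 0 \<le> c z \<and> c z \<le> B" and B: "0 < B"
    and cm: "c \<in> borel_measurable (restrict_space borel (UNIV \<times> U))"
    and conv: "converges_tv (\<lambda>i. joint P (q i)) (joint P Q)" and e: "0 < e"
  shows "\<forall>\<^sub>F i in sequentially. optimal_cost U c P Q - e \<le> optimal_cost U c P (q i)"
proof -
  have "(\<lambda>i. B * (tv_distance (joint P (q i)) (joint P Q) / 2)) \<longlonglongrightarrow> B * (0 / 2)"
    using conv unfolding converges_tv_def by (intro tendsto_intros) auto
  then have "\<forall>\<^sub>F i in sequentially. B * (tv_distance (joint P (q i)) (joint P Q) / 2) < e"
    using e by (intro order_tendstoD(2)) auto
  then show ?thesis
  proof eventually_elim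
    case (elim i)
    show ?case
      unfolding optimal_cost_def[of U c P "q i"]
    proof (rule cINF_greatest)
      fix \<gamma> :: "'y \<Rightarrow> 'u" assume \<gamma>: "\<gamma> \<in> policies U"
      have "optimal_cost U c P Q \<le> (\<integral>(x, y). c (x, \<gamma> y) \<partial>joint P Q)"
        using c \<gamma> by (intro optimal_cost_le) auto
      moreover have "\<bar>(\<integral>(x, y). c (x, \<gamma> y) \<partial>joint P (q i)) - (\<integral>(x, y). c (x, \<gamma> y) \<partial>joint P Q)\<bar>
          \<le> B * (tv_distance (joint P (q i)) (joint P Q) / 2)"
        by (rule integral_diff_le_tv_distance[OF prob_space_joint[OF P Q(2)] sets_joint[OF P Q(2)]
              prob_space_joint[OF P Q(1)] sets_joint[OF P Q(1)] policy_cost_measurable[OF cm \<gamma>]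
              policy_cost_bounds[OF c \<gamma>] B])
      ultimately show "optimal_cost U c P Q - e \<le> (\<integral>(x, y). c (x, \<gamma> y) \<partial>joint P (q i))"
        using elim by linarith
    qed (use U constant_policy in blast)
  qed
qed

section \<open>Existence of worst and best channels\<close>

lemma worst_channel_exists:
  fixes \<Q> :: "('x::second_countable_topology \<Rightarrow> 'y::second_countable_topology measure) set"
  assumes ne: "\<Q> \<noteq> {}" and bdd: "bdd_above (optimal_cost U c P ` \<Q>)"
    and comp: "compact_at_input conv P \<Q>"
    and usc: "\<And>q Q e. (\<And>i. q i \<in> \<Q>) \<Longrightarrow> Q \<in> \<Q> \<Longrightarrow>
        conv (\<lambda>i. joint P (q i)) (joint P Q) \<Longrightarrow> 0 < e \<Longrightarrow>
        \<forall>\<^sub>F i in sequentially. optimal_cost U c P (q i) \<le> optimal_cost U c P Q + e"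
  shows "\<exists>Q. worst_channel U c P \<Q> Q"
proof -
  have "\<exists>Q\<in>\<Q>. optimal_cost U c P Q = (SUP Q\<in>\<Q>. optimal_cost U c P Q)"
  proof (rule usc_attains_sup[OF ne bdd, where conv = "\<lambda>q Q. conv (\<lambda>i. joint P (q i)) (joint P Q)"])
    fix q :: "nat \<Rightarrow> 'x \<Rightarrow> 'y measure" assume "\<And>i. q i \<in> \<Q>"
    then show "\<exists>Q\<in>\<Q>. \<exists>r::nat \<Rightarrow> nat. strict_mono r \<and> conv (\<lambda>i. joint P ((q \<circ> r) i)) (joint P Q)"
      using comp unfolding compact_at_input_def by (simp add: comp_def)
  qed (rule usc)
  then show ?thesis using bdd unfolding worst_channel_def by blast
qed

lemma best_channel_exists:
  fixes \<Q> :: "('x::second_countable_topology \<Rightarrow> 'y::second_countable_topology measure) set"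
  assumes ne: "\<Q> \<noteq> {}" and bdd: "bdd_below (optimal_cost U c P ` \<Q>)"
    and comp: "compact_at_input conv P \<Q>"
    and lsc: "\<And>q Q e. (\<And>i. q i \<in> \<Q>) \<Longrightarrow> Q \<in> \<Q> \<Longrightarrow>
        conv (\<lambda>i. joint P (q i)) (joint P Q) \<Longrightarrow> 0 < e \<Longrightarrow>
        \<forall>\<^sub>F i in sequentially. optimal_cost U c P Q - e \<le> optimal_cost U c P (q i)"
  shows "\<exists>Q. best_channel U c P \<Q> Q"
proof -
  have "bdd_above ((\<lambda>Q. - optimal_cost U c P Q) ` \<Q>)"
    using bdd bdd_above_uminus[of "optimal_cost U c P ` \<Q>"] by (simp add: image_image)
  then have "\<exists>Q\<in>\<Q>. - optimal_cost U c P Q = (SUP Q\<in>\<Q>. - optimal_cost U c P Q)"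
  proof (rule usc_attains_sup[OF ne, where conv = "\<lambda>q Q. conv (\<lambda>i. joint P (q i)) (joint P Q)"])
    fix q :: "nat \<Rightarrow> 'x \<Rightarrow> 'y measure" assume "\<And>i. q i \<in> \<Q>"
    then show "\<exists>Q\<in>\<Q>. \<exists>r::nat \<Rightarrow> nat. strict_mono r \<and> conv (\<lambda>i. joint P ((q \<circ> r) i)) (joint P Q)"
      using comp unfolding compact_at_input_def by (simp add: comp_def)
  next
    fix q Q and e :: real
    assume "\<And>i. q i \<in> \<Q>" "Q \<in> \<Q>" "conv (\<lambda>i. joint P (q i)) (joint P Q)" "0 < e"
    from lsc[OF this]
    show "\<forall>\<^sub>F i in sequentially. - optimal_cost U c P (q i) \<le> - optimal_cost U c P Q + e"
      by eventually_elim simp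
  qed
  then show ?thesis
    using bdd Inf_real_def[of "optimal_cost U c P ` \<Q>"]
    unfolding best_channel_def by (auto simp: image_image)
qed

theorem theorem4p5:
  fixes P :: "(real ^ 'n) measure"
    and U :: "(real ^ 'k) set"
    and c :: "(real ^ 'n) \<times> (real ^ 'k) \<Rightarrow> real"
    and \<Q> :: "(real ^ 'n \<Rightarrow> (real ^ 'm) measure) set"
  assumes "prob_space P" and "sets P = sets borel"
    and "U \<in> sets borel" and "U \<noteq> {}"
    and "\<Q> \<noteq> {}" and "\<And>Q. Q \<in> \<Q> \<Longrightarrow> is_channel Q"
  shows
    "(compact_at_input converges_weakly P \<Q> \<longrightarrow>
      (\<forall>z\<in>UNIV \<times> U. 0 \<le> c z) \<longrightarrow> bounded (c ` (UNIV \<times> U)) \<longrightarrow> continuous_on (UNIV \<times> U) c \<longrightarrow>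
      compact U \<longrightarrow> convex U \<longrightarrow>
        (\<exists>Q. worst_channel U c P \<Q> Q))
     \<and>
     (compact_at_input converges_setwise P \<Q> \<longrightarrow>
      (\<forall>z\<in>UNIV \<times> U. 0 \<le> c z) \<longrightarrow> bounded (c ` (UNIV \<times> U)) \<longrightarrow>
      c \<in> borel_measurable (restrict_space borel (UNIV \<times> U)) \<longrightarrow>
        (\<exists>Q. worst_channel U c P \<Q> Q))
     \<and>
     (compact_at_input converges_tv P \<Q> \<longrightarrow>
      (\<forall>z\<in>UNIV \<times> U. 0 \<le> c z) \<longrightarrow> bounded (c ` (UNIV \<times> U)) \<longrightarrow>
      c \<in> borel_measurable (restrict_space borel (UNIV \<times> U)) \<longrightarrow>
        (\<exists>Q. best_channel U c P \<Q> Q) \<and> (\<exists>Q. worst_channel U c P \<Q> Q))"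
proof -
  note P = assms(1,2) and U = assms(4) and ne = assms(5) and ch = assms(6)
  have bound: "\<exists>B>0. \<forall>z\<in>UNIV \<times> U. 0 \<le> c z \<and> c z \<le> B"
    if "\<forall>z\<in>UNIV \<times> U. 0 \<le> c z" "bounded (c ` (UNIV \<times> U))"
    using that unfolding bounded_pos by fastforce
  have bdd: "bdd_above (optimal_cost U c P ` \<Q>) \<and> bdd_below (optimal_cost U c P ` \<Q>)"
    if "\<forall>z\<in>UNIV \<times> U. 0 \<le> c z \<and> c z \<le> B" "c \<in> borel_measurable (restrict_space borel (UNIV \<times> U))" for B
    using optimal_cost_bounds[OF P ch U that]
    by (intro conjI bdd_aboveI2[of _ _ B] bdd_belowI2[of _ 0]) auto
  have weak: "\<exists>Q. worst_channel U c P \<Q> Q"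
    if comp: "compact_at_input converges_weakly P \<Q>" and nn: "\<forall>z\<in>UNIV \<times> U. 0 \<le> c z"
      and bd: "bounded (c ` (UNIV \<times> U))" and cc: "continuous_on (UNIV \<times> U) c" and cvx: "convex U"
  proof -
    obtain B where B: "0 < B" and cB: "\<forall>z\<in>UNIV \<times> U. 0 \<le> c z \<and> c z \<le> B" using bound[OF nn bd] by blast
    show ?thesis
      using bdd[OF cB borel_measurable_continuous_on_restrict[OF cc]]
      by (intro worst_channel_exists[OF ne _ comp])
         (auto intro: optimal_cost_usc_weakly[OF P ch cvx U cB B cc])
  qed
  have setw: "\<exists>Q. worst_channel U c P \<Q> Q"
    if comp: "compact_at_input conv P \<Q>" and nn: "\<forall>z\<in>UNIV \<times> U. 0 \<le> c z"
      and bd: "bounded (c ` (UNIV \<times> U))"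
      and cm: "c \<in> borel_measurable (restrict_space borel (UNIV \<times> U))"
      and imp: "\<And>q Q. (\<And>i. q i \<in> \<Q>) \<Longrightarrow> Q \<in> \<Q> \<Longrightarrow> conv (\<lambda>i. joint P (q i)) (joint P Q) \<Longrightarrow>
                  converges_setwise (\<lambda>i. joint P (q i)) (joint P Q)" for conv
  proof -
    obtain B where B: "0 < B" and cB: "\<forall>z\<in>UNIV \<times> U. 0 \<le> c z \<and> c z \<le> B" using bound[OF nn bd] by blast
    show ?thesis
      using bdd[OF cB cm]
      by (intro worst_channel_exists[OF ne _ comp])
         (auto intro: optimal_cost_usc_setwise[OF P ch ch U cB B cm] imp)
  qed
  have best: "\<exists>Q. best_channel U c P \<Q> Q"
    if comp: "compact_at_input converges_tv P \<Q>" and nn: "\<forall>z\<in>UNIV \<times> U. 0 \<le> c z"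
      and bd: "bounded (c ` (UNIV \<times> U))"
      and cm: "c \<in> borel_measurable (restrict_space borel (UNIV \<times> U))"
  proof -
    obtain B where B: "0 < B" and cB: "\<forall>z\<in>UNIV \<times> U. 0 \<le> c z \<and> c z \<le> B" using bound[OF nn bd] by blast
    show ?thesis
      using bdd[OF cB cm]
      by (intro best_channel_exists[OF ne _ comp])
         (auto intro: optimal_cost_lsc_tv[OF P ch ch U cB B cm])
  qed
  have tv: "converges_setwise (\<lambda>i. joint P (q i)) (joint P Q)"
    if "\<And>i. q i \<in> \<Q>" "Q \<in> \<Q>" "converges_tv (\<lambda>i. joint P (q i)) (joint P Q)" for q Q
    using that by (intro converges_tv_imp_setwise prob_space_joint P ch)
  show ?thesis
    using weak setw[of converges_setwise] setw[of converges_tv] best tv by blast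
qed

end
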